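(* Let $(V,* )$ be a finite groupoid. Then the following statements are equivalent: (1) $(V,* )$ is a travel groupoid on a complete graph; (2) $u*v=v$ for all $u,v\in V$; (3) $(V,* )$ is a travel groupoid satisfying the associativity $(u*v)*w=u*(v*w)$ for all $u,v,w\in V$.
   Context: A groupoid $(V,* )$ is a nonempty set $V$ with a binary operation $*:V\times V\to V$. It is a travel groupoid if (t1) $(u*v)*u=u$ for all $u,v\in V$, and (t2) for all $u,v\in V$, if $(u*v)*v=u$ then $u=v$. The associated graph $G_V$ of a travel groupoid has vertex set $V$ and edge set $\{\{u,v\} : u,v\in V,\ u\neq u*v=v\}$; $(V,* )$ is said to be on a graph $G$ if $G=G_V$. Graphs are finite, undirected, with no multiple edges or loops. *)

theory Defs
  imports Main
begin

locale groupoid =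
  fixes V :: "'a set" and mult :: "'a \<Rightarrow> 'a \<Rightarrow> 'a"  (infixl \<open>*\<^sub>V\<close> 70)
  assumes nonempty: "V \<noteq> {}"
    and closed: "\<And>u v. u \<in> V \<Longrightarrow> v \<in> V \<Longrightarrow> u *\<^sub>V v \<in> V"

locale travel_groupoid = groupoid +
  assumes t1: "\<And>u v. u \<in> V \<Longrightarrow> v \<in> V \<Longrightarrow> (u *\<^sub>V v) *\<^sub>V u = u"
    and t2: "\<And>u v. u \<in> V \<Longrightarrow> v \<in> V \<Longrightarrow> (u *\<^sub>V v) *\<^sub>V v = u \<Longrightarrow> u = v"

text \<open>Graphs are pairs (vertices, edges), an edge being an unordered pair, i.e. a two-element
  set of vertices.\<close>

type_synonym 'a ugraph = "'a set \<times> 'a set set"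

definition simple_graph :: "'a ugraph \<Rightarrow> bool" where
  "simple_graph G \<longleftrightarrow> finite (fst G) \<and> (\<forall>e\<in>snd G. e \<subseteq> fst G \<and> card e = 2)"

definition complete_graph :: "'a ugraph \<Rightarrow> bool" where
  "complete_graph G \<longleftrightarrow>
     simple_graph G \<and> (\<forall>u\<in>fst G. \<forall>v\<in>fst G. u \<noteq> v \<longrightarrow> {u, v} \<in> snd G)"

definition assoc_graph :: "'a set \<Rightarrow> ('a \<Rightarrow> 'a \<Rightarrow> 'a) \<Rightarrow> 'a ugraph" where
  "assoc_graph V f = (V, {{u, v} | u v. u \<in> V \<and> v \<in> V \<and> u \<noteq> f u v \<and> f u v = v})"

definition travel_groupoid_on :: "'a set \<Rightarrow> ('a \<Rightarrow> 'a \<Rightarrow> 'a) \<Rightarrow> 'a ugraph \<Rightarrow> bool" where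
  "travel_groupoid_on V f G \<longleftrightarrow> travel_groupoid V f \<and> G = assoc_graph V f"

end

theory Submission
  imports Defs
begin

text \<open>The pivot is the right projection \<open>u * v = v\<close>. Completeness yields it off
  the diagonal, since every edge fixes the products of its ends; on the diagonal it is idempotence
  (\<open>idem\<close>). Associativity and idempotence make right multiplication by \<open>v\<close>
  fix \<open>u * v\<close>, and (t2) then forces \<open>u * v = v\<close>. Conversely, a right
  projection satisfies all the laws by evaluation and joins any two distinct vertices.\<close>

context travel_groupoid
begin

text \<open>By (t1), \<open>(u * u) * u = u\<close>; hence (t2) applies to the pair \<open>u * u\<close>, \<open>u\<close>.\<close>

lemma idem:
  assumes "u \<in> V"
  shows "u *\<^sub>V u = u"
  using assms by (metis closed t1 t2)

text \<open>Edges are unordered, so one only gives \<open>u * v = v\<close> or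
  \<open>v * u = u\<close>; in the second case (t1) for \<open>v\<close>, \<open>u\<close> turns
  into \<open>u * v = v\<close>.\<close>

lemma right_proj_if_edge:
  assumes "u \<in> V" "v \<in> V" "{u, v} \<in> snd (assoc_graph V (*\<^sub>V))"
  shows "u *\<^sub>V v = v"
proof -
  from assms(3) have "u *\<^sub>V v = v \<or> v *\<^sub>V u = u"
    by (auto simp: assoc_graph_def doubleton_eq_iff)
  with t1[OF assms(2,1)] show ?thesis by auto
qed

text \<open>Completeness is silent about equal vertices, so the diagonal is left to
  idempotence.\<close>

lemma right_proj_if_complete:
  assumes "complete_graph (assoc_graph V (*\<^sub>V))" "u \<in> V" "v \<in> V"
  shows "u *\<^sub>V v = v"
proof (cases "u = v")
  case False
  moreover have "fst (assoc_graph V (*\<^sub>V)) = V"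
    by (simp add: assoc_graph_def)
  ultimately show ?thesis
    using assms by (auto simp: complete_graph_def intro: right_proj_if_edge)
qed (use assms idem in simp)

lemma right_proj_if_assoc:
  assumes assoc: "\<And>u v w. u \<in> V \<Longrightarrow> v \<in> V \<Longrightarrow> w \<in> V \<Longrightarrow> (u *\<^sub>V v) *\<^sub>V w = u *\<^sub>V (v *\<^sub>V w)"
    and "u \<in> V" "v \<in> V"
  shows "u *\<^sub>V v = v"
\<comment> \<open>(t2) is applied to the pair \<open>u * v\<close>, \<open>v\<close>; its premise
  follows from \<open>(u * v) * v = u * (v * v) = u * v\<close>, used twice.\<close>
proof (rule t2)
  have "(u *\<^sub>V v) *\<^sub>V v = u *\<^sub>V v"
    using assms idem by simp
  then show "((u *\<^sub>V v) *\<^sub>V v) *\<^sub>V v = u *\<^sub>V v" by simp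
qed (use assms closed in auto)

end

lemma travel_groupoid_right_proj:
  assumes "groupoid V f" "\<And>u v. u \<in> V \<Longrightarrow> v \<in> V \<Longrightarrow> f u v = v"
  shows "travel_groupoid V f"
  using assms by (simp add: travel_groupoid_def travel_groupoid_axioms_def)

lemma complete_assoc_graph_right_proj:
  assumes "finite V" "\<And>u v. u \<in> V \<Longrightarrow> v \<in> V \<Longrightarrow> f u v = v"
  shows "complete_graph (assoc_graph V f)"
  using assms
  by (fastforce simp: complete_graph_def simple_graph_def assoc_graph_def card_2_iff)

theorem theorem4p1:
  fixes V :: "'a set" and f :: "'a \<Rightarrow> 'a \<Rightarrow> 'a"
  assumes "groupoid V f" and "finite V"
  shows "((\<exists>G. complete_graph G \<and> travel_groupoid_on V f G)
            \<longleftrightarrow> (\<forall>u\<in>V. \<forall>v\<in>V. f u v = v)) \<and>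
         ((\<forall>u\<in>V. \<forall>v\<in>V. f u v = v)
            \<longleftrightarrow> travel_groupoid V f \<and>
                (\<forall>u\<in>V. \<forall>v\<in>V. \<forall>w\<in>V. f (f u v) w = f u (f v w)))"
proof (intro conjI iffI)
  assume "\<exists>G. complete_graph G \<and> travel_groupoid_on V f G"
  then show "\<forall>u\<in>V. \<forall>v\<in>V. f u v = v"
    by (auto simp: travel_groupoid_on_def intro: travel_groupoid.right_proj_if_complete)
next
  assume "\<forall>u\<in>V. \<forall>v\<in>V. f u v = v"
  then show "\<exists>G. complete_graph G \<and> travel_groupoid_on V f G"
    \<comment> \<open>The only possible witness is \<open>assoc_graph V f\<close>; finiteness of
      \<open>V\<close> makes it a simple graph.\<close>
    using assms travel_groupoid_right_proj[of V f] complete_assoc_graph_right_proj[of V f]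
    unfolding travel_groupoid_on_def by blast
next
  assume "\<forall>u\<in>V. \<forall>v\<in>V. f u v = v"
  then show "travel_groupoid V f"
    using assms(1) by (simp add: travel_groupoid_right_proj)
next
  assume "\<forall>u\<in>V. \<forall>v\<in>V. f u v = v"
  then show "\<forall>u\<in>V. \<forall>v\<in>V. \<forall>w\<in>V. f (f u v) w = f u (f v w)"
    by simp
next
  assume "travel_groupoid V f \<and> (\<forall>u\<in>V. \<forall>v\<in>V. \<forall>w\<in>V. f (f u v) w = f u (f v w))"
  then show "\<forall>u\<in>V. \<forall>v\<in>V. f u v = v"
    using travel_groupoid.right_proj_if_assoc[of V f] by blast
qed

end
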